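(* For every integer $n\ge 1$, the following identity of polynomials in $x$ over $\mathbb{C}$ holds: $$B_n^{(n)}(x+1)=\sum_{l=0}^{n}S_1(n,l)\,\frac{1}{l+1}\left((x+1)^{l+1}-x^{l+1}\right).$$
   Context: For an integer $r\ge 0$, the Bernoulli polynomials of order $r$ are defined by $\left(\frac{t}{e^t-1}\right)^r e^{xt}=\sum_{n=0}^{\infty}B_n^{(r)}(x)\frac{t^n}{n!}$. $S_1(n,l)$ denotes the (signed) Stirling numbers of the first kind, defined by $(x)_n=\sum_{l=0}^{n}S_1(n,l)x^l$, where $(x)_n=x(x-1)\cdots(x-n+1)$. *)

theory Defs
  imports "HOL-Computational_Algebra.Computational_Algebra"
begin

definition falling_factorial_poly :: "nat \<Rightarrow> int poly" where
  "falling_factorial_poly n = (\<Prod>i<n. [:- int i, 1:])"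

definition S1 :: "nat \<Rightarrow> nat \<Rightarrow> int" where
  "S1 n l = coeff (falling_factorial_poly n) l"

lemma falling_factorial_S1:
  fixes x :: int
  shows "(\<Prod>i<n. x - int i) = (\<Sum>l=0..n. S1 n l * x ^ l)"
proof -
  have d: "degree (falling_factorial_poly n) = n"
    unfolding falling_factorial_poly_def by (subst degree_prod_eq_sum_degree) auto
  have "(\<Prod>i<n. x - int i) = poly (falling_factorial_poly n) x"
    by (simp add: falling_factorial_poly_def poly_prod)
  also have "\<dots> = (\<Sum>l=0..n. S1 n l * x ^ l)"
    by (simp add: poly_altdef d S1_def atMost_atLeast0)
  finally show ?thesis .
qed

(* The generating function is a power series in t whose coefficients are
   polynomials in x.  The factor (t / (e^t - 1))^r is formed over the complex
   numbers and embedded as a series with constant polynomials as coefficients;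
   exp_xt is e^(x t), with t^n-coefficient x^n / n!. *)

definition bernoulli_factor :: "nat \<Rightarrow> complex fps" where
  "bernoulli_factor r = (fps_X / (fps_exp 1 - 1)) ^ r"

definition exp_xt :: "complex poly fps" where
  "exp_xt = Abs_fps (\<lambda>n. monom (1 / fact n) n)"

definition bernoulli_poly :: "nat \<Rightarrow> nat \<Rightarrow> complex poly" where
  "bernoulli_poly r n =
     smult (fact n)
       (fps_nth (Abs_fps (\<lambda>k. [:fps_nth (bernoulli_factor r) k:]) * exp_xt) n)"

(* Since e^t - 1 is not a unit in the ring of power series, fps_X / (fps_exp 1 - 1)
   relies on the library's division cancelling the common factor t. *)

lemma fps_X_div_fps_exp_minus_1:
  "(fps_X / (fps_exp 1 - 1)) * (fps_exp 1 - 1) = (fps_X :: complex fps)"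
proof -
  have nz: "fps_exp 1 - 1 \<noteq> (0 :: complex fps)"
  proof
    assume "fps_exp 1 - 1 = (0 :: complex fps)"
    then have "fps_nth (fps_exp 1 - 1 :: complex fps) 1 = 0" by simp
    then show False by simp
  qed
  have "subdegree (fps_exp 1 - 1 :: complex fps) = 1"
    by (rule subdegreeI) auto
  then have "fps_exp 1 - 1 dvd (fps_X :: complex fps)"
    using nz by (simp add: fps_dvd_iff)
  then show ?thesis by simp
qed

lemma bernoulli_poly_gen_fun:
  "Abs_fps (\<lambda>n. poly (bernoulli_poly r n) x / fact n) =
     (fps_X / (fps_exp 1 - 1)) ^ r * fps_exp x"
  by (rule fps_ext)
    (simp add: bernoulli_poly_def bernoulli_factor_def exp_xt_def fps_mult_nth
      poly_sum poly_monom)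

end

theory Submission
  imports Defs
begin

text \<open>
  Write \<open>T = t / (e\<^sup>t - 1)\<close>. From \<open>T (e\<^sup>t - 1) = t\<close> one gets the differential equation
  \<open>t T' = T - T\<^sup>2 - t T\<close>, and comparing coefficients of \<open>t\<^sup>n\<close> in \<open>t (T\<^sup>n e\<^bsup>xt\<^esup>)'\<close> gives
  \<open>B\<^sub>n\<^bsup>(n+1)\<^esup>(x) = (x - n) B\<^bsub>n-1\<^esub>\<^bsup>(n)\<^esup>(x)\<close>, hence \<open>B\<^sub>n\<^bsup>(n+1)\<^esup>(x + 1) = (x)\<^sub>n\<close>.
  So \<open>B\<^bsub>n+1\<^esub>\<^bsup>(n+1)\<^esup>(x + 1) / (n + 1)\<close> is an antiderivative of the falling factorial \<open>(x)\<^sub>n\<close>,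
  as is \<open>\<Sum>l. S\<^sub>1(n,l) x\<^bsup>l+1\<^esup> / (l + 1)\<close>. Two antiderivatives have the same unit
  forward difference, and that of the former is \<open>B\<^sub>n\<^bsup>(n)\<^esup>(x + 1)\<close>.
\<close>

abbreviation bernoulli_gf :: "complex fps" where
  "bernoulli_gf \<equiv> fps_X / (fps_exp 1 - 1)"

lemma poly_bernoulli_poly:
  "poly (bernoulli_poly r n) x = fact n * fps_nth (bernoulli_gf ^ r * fps_exp x) n"
  unfolding bernoulli_poly_gen_fun [symmetric] by simp

text \<open>Only the \<open>t^k\<close> term of \<open>exp_xt\<close> carries \<open>x^k\<close>, so
  the Cauchy product collapses to one summand. This form makes the derivative rule a comparison of
  coefficients.\<close>

lemma coeff_bernoulli_poly:
  "coeff (bernoulli_poly r n) k =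
     (if k \<le> n then fact n / fact k * fps_nth (bernoulli_factor r) (n - k) else 0)"
proof -
  have "coeff (bernoulli_poly r n) k =
      fact n * (\<Sum>i=0..n. if i + k = n then fps_nth (bernoulli_factor r) i / fact (n - i) else 0)"
    by (auto simp: bernoulli_poly_def exp_xt_def fps_mult_nth coeff_sum intro!: sum.cong)
  also have "(\<Sum>i=0..n. if i + k = n then fps_nth (bernoulli_factor r) i / fact (n - i) else 0) =
      (\<Sum>i=0..n. if i = n - k \<and> k \<le> n then fps_nth (bernoulli_factor r) i / fact k else 0)"
    by (intro sum.cong) auto
  finally show ?thesis
    by auto
qed

lemma pderiv_bernoulli_poly:
  "pderiv (bernoulli_poly r (Suc n)) = smult (of_nat (Suc n)) (bernoulli_poly r n)"
  by (rule poly_eqI) (simp add: coeff_pderiv coeff_bernoulli_poly del: of_nat_Suc)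

lemma bernoulli_gf_exp: "bernoulli_gf * fps_exp 1 = bernoulli_gf + fps_X"
  using fps_X_div_fps_exp_minus_1 by (simp add: algebra_simps)

lemma fps_X_mult_deriv_bernoulli_gf:
  "fps_X * fps_deriv bernoulli_gf = bernoulli_gf - bernoulli_gf ^ 2 - fps_X * bernoulli_gf"
proof -
  let ?T = bernoulli_gf and ?E = "fps_exp 1 :: complex fps"
  have "fps_deriv (?T * (?E - 1)) = 1"
    by (simp add: fps_X_div_fps_exp_minus_1)
  then have "fps_deriv ?T * (?E - 1) + ?T * ?E = 1"
    by (simp add: algebra_simps)
  \<comment> \<open>Multiplying by \<open>?T\<close> turns \<open>?E - 1\<close> into
    \<open>fps_X\<close> and \<open>?T * ?E\<close> into \<open>?T + fps_X\<close>, which eliminates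
    the exponential without division.\<close>
  then have "?T * (fps_deriv ?T * (?E - 1) + ?T * ?E) = ?T"
    by simp
  then have "fps_deriv ?T * (?T * (?E - 1)) + ?T * (?T * ?E) = ?T"
    by (simp add: algebra_simps)
  then show ?thesis
    unfolding fps_X_div_fps_exp_minus_1 bernoulli_gf_exp
    by (simp add: algebra_simps power2_eq_square)
qed

lemma poly_bernoulli_poly_Suc_Suc:
  "poly (bernoulli_poly (Suc (Suc n)) (Suc n)) x =
     (x - of_nat (Suc n)) * poly (bernoulli_poly (Suc n) n) x"
proof -
  let ?T = bernoulli_gf
  let ?G = "?T ^ Suc n * fps_exp x"
  let ?m = "of_nat (Suc n) :: complex"
  have "fps_X * fps_deriv ?G =
      fps_const ?m * ?T ^ n * (fps_X * fps_deriv ?T) * fps_exp x + fps_X * (fps_const x * ?G)"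
    by (simp add: fps_deriv_power algebra_simps del: power_Suc of_nat_Suc)
  also have "\<dots> = fps_const ?m * ?G - fps_const ?m * (?T ^ Suc (Suc n) * fps_exp x)
      + fps_X * (fps_const (x - ?m) * ?G)"
    unfolding fps_X_mult_deriv_bernoulli_gf
    by (simp add: algebra_simps power2_eq_square flip: fps_const_sub)
  finally have "fps_nth (fps_X * fps_deriv ?G) (Suc n) = fps_nth (\<dots>) (Suc n)"
    by (rule arg_cong)
  \<comment> \<open>The index \<open>Suc n\<close> equals the exponent of \<open>?T\<close> in
    \<open>?G\<close>, so this term cancels against \<open>fps_const ?m * ?G\<close>.\<close>
  moreover have "fps_nth (fps_X * fps_deriv F) (Suc n) = ?m * fps_nth F (Suc n)" for F
    by simp
  ultimately have "?m * fps_nth (?T ^ Suc (Suc n) * fps_exp x) (Suc n) = (x - ?m) * fps_nth ?G n"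
    by (simp del: power_Suc of_nat_Suc fps_deriv_mult)
  then show ?thesis
    unfolding poly_bernoulli_poly fact_Suc by (simp only: ac_simps)
qed

lemma poly_bernoulli_poly_Suc:
  "poly (bernoulli_poly (Suc n) n) (x + 1) = (\<Prod>i<n. x - of_nat i)"
proof (induction n)
  case 0
  \<comment> \<open>As \<open>fps_exp 1 - 1\<close> starts with \<open>t\<close>, this coefficient
    is the constant term of \<open>bernoulli_gf\<close>.\<close>
  have "fps_nth (bernoulli_gf * (fps_exp 1 - 1)) 1 = 1"
    by (simp only: fps_X_div_fps_exp_minus_1 fps_X_nth) simp
  then show ?case
    by (simp add: poly_bernoulli_poly fps_mult_nth)
next
  case (Suc n)
  then show ?case
    by (simp add: poly_bernoulli_poly_Suc_Suc del: power_Suc)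
qed

text \<open>Splitting off the last linear factor gives the same coefficient recurrence in every
  commutative ring, so the integers \<open>S1\<close> also serve over the complex numbers.\<close>

lemma coeff_falling_factorial_eq_S1:
  "coeff (\<Prod>i<n. [:- of_nat i, 1:] :: 'a :: comm_ring_1 poly) l = of_int (S1 n l)"
proof (induction n arbitrary: l)
  case 0
  show ?case
    by (simp add: S1_def falling_factorial_poly_def)
next
  case (Suc n)
  then show ?case
    by (auto simp: S1_def falling_factorial_poly_def mult.commute coeff_pCons split: nat.split)
qed

lemma falling_factorial_sum_S1:
  fixes x :: "'a :: idom"
  shows "(\<Prod>i<n. x - of_nat i) = (\<Sum>l\<le>n. of_int (S1 n l) * x ^ l)"
proof -
  let ?p = "\<Prod>i<n. [:- of_nat i, 1:] :: 'a poly"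
  have "degree ?p = n"
    by (subst degree_prod_eq_sum_degree) auto
  then have "poly ?p x = (\<Sum>l\<le>n. of_int (S1 n l) * x ^ l)"
    by (simp add: poly_altdef coeff_falling_factorial_eq_S1)
  then show ?thesis
    by (simp add: poly_prod)
qed

text \<open>The difference of exponentials has the factor \<open>e^t - 1\<close>, which absorbs one
  power of \<open>bernoulli_gf\<close> and leaves \<open>t\<close>: both order and index drop by
  one.\<close>

lemma poly_bernoulli_poly_diff:
  "poly (bernoulli_poly (Suc r) (Suc n)) (x + 1) - poly (bernoulli_poly (Suc r) (Suc n)) x =
     of_nat (Suc n) * poly (bernoulli_poly r n) x"
proof -
  have "bernoulli_gf ^ Suc r * fps_exp (x + 1) - bernoulli_gf ^ Suc r * fps_exp x =
      bernoulli_gf ^ r * fps_exp x * (bernoulli_gf * (fps_exp 1 - 1))"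
    by (simp add: fps_exp_add_mult algebra_simps)
  also have "\<dots> = fps_X * (bernoulli_gf ^ r * fps_exp x)"
    unfolding fps_X_div_fps_exp_minus_1 by (rule mult.commute)
  finally have "fps_nth (bernoulli_gf ^ Suc r * fps_exp (x + 1)
      - bernoulli_gf ^ Suc r * fps_exp x) (Suc n) = fps_nth (bernoulli_gf ^ r * fps_exp x) n"
    by simp
  then show ?thesis
    unfolding poly_bernoulli_poly by (simp del: power_Suc add: algebra_simps)
qed

lemma poly_diff_eq_if_pderiv_eq:
  fixes p q :: "'a :: {idom, semiring_char_0} poly"
  assumes "pderiv p = pderiv q"
  shows "poly p x - poly p y = poly q x - poly q y"
proof -
  have "pderiv (p - q) = 0"
    using assms by (simp add: pderiv_diff)
  then have "degree (p - q) = 0"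
    by (simp add: pderiv_eq_0_iff)
  then obtain c where "p - q = [:c:]"
    by (rule degree_eq_zeroE)
  then have "p = q + [:c:]"
    by (simp add: algebra_simps)
  then show ?thesis
    by simp
qed

theorem theorem3:
  fixes n :: nat
  assumes "n \<ge> 1"
  shows "pcompose (bernoulli_poly n n) [:1, 1:] =
    (\<Sum>l=0..n. smult (of_int (S1 n l) * (1 / of_nat (l + 1)))
       ([:1, 1:] ^ (l + 1) - [:0, 1:] ^ (l + 1)))"
proof (rule poly_eq_poly_eq_iff [THEN iffD1], rule ext)
  fix x :: complex
  let ?B = "bernoulli_poly (Suc n) (Suc n)"
  define P where "P = pcompose ?B [:1, 1:]"
  define R :: "complex poly" where
    "R = (\<Sum>l\<le>n. monom (of_int (S1 n l) / of_nat (l + 1)) (l + 1))"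
  have "pderiv P = smult (of_nat (Suc n)) (pderiv R)"
  proof (rule poly_eq_poly_eq_iff [THEN iffD1], rule ext)
    fix y :: complex
    have "poly (pderiv R) y = (\<Sum>l\<le>n. of_int (S1 n l) * y ^ l)"
      unfolding R_def by (simp add: higher_pderiv_sum [of 1, simplified] pderiv_monom poly_sum poly_monom del: of_nat_Suc)
    also have "\<dots> = poly (bernoulli_poly (Suc n) n) (y + 1)"
      by (simp add: falling_factorial_sum_S1 poly_bernoulli_poly_Suc)
    finally show "poly (pderiv P) y = poly (smult (of_nat (Suc n)) (pderiv R)) y"
      by (simp add: P_def pderiv_pcompose poly_pcompose pderiv_bernoulli_poly pderiv_pCons
          add.commute del: of_nat_Suc)
  qed
  then have "pderiv P = pderiv (smult (of_nat (Suc n)) R)"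
    by (simp add: pderiv_smult)
  then have "poly P (x + 1) - poly P x = of_nat (Suc n) * (poly R (x + 1) - poly R x)"
    using poly_diff_eq_if_pderiv_eq [of P _ "x + 1" x]
    by (metis poly_smult right_diff_distrib)
  moreover have "poly P (x + 1) - poly P x =
      of_nat (Suc n) * poly (bernoulli_poly n n) (x + 1)"
    \<comment> \<open>The base point is \<open>x + 1\<close> because \<open>P\<close> already
      contains a unit shift.\<close>
    using poly_bernoulli_poly_diff [of n n "x + 1"]
    by (simp add: P_def poly_pcompose add.commute del: of_nat_Suc)
  ultimately have "poly (bernoulli_poly n n) (x + 1) = poly R (x + 1) - poly R x"
    by (simp del: of_nat_Suc)
  also have "\<dots> = (\<Sum>l=0..n. of_int (S1 n l) * (1 / of_nat (l + 1)) *
      ((x + 1) ^ (l + 1) - x ^ (l + 1)))"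
    by (simp add: R_def poly_sum poly_monom atMost_atLeast0 algebra_simps
        flip: sum_subtractf del: of_nat_Suc power_Suc)
  finally show "poly (pcompose (bernoulli_poly n n) [:1, 1:]) x =
      poly (\<Sum>l=0..n. smult (of_int (S1 n l) * (1 / of_nat (l + 1)))
        ([:1, 1:] ^ (l + 1) - [:0, 1:] ^ (l + 1))) x"
    by (simp add: poly_pcompose poly_sum poly_power add.commute del: of_nat_Suc power_Suc)
qed

end
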